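(* Let $d=mJ$ with integers $m\ge 2$, $J\ge 1$ and $d$ odd, and let $a,f\in\ell^2(\mathbb Z_d)$. Let $L\ge 1$ be an integer, fix $j\in\mathbb Z_J=\{0,1,\dots,J-1\}$, and define $$y_\ell=S_m(a^\ell*f)\in\ell^2(\mathbb Z_J),\qquad s_\ell(j):=\widehat{y_\ell}(j),\qquad \ell\in\{0,\dots,L-1\}.$$ For an integer $K\ge 1$ with $2K\le L$, define the $K\times K$ Hankel matrix $$H_K(j):=\bigl[s_{p+q}(j)\bigr]_{p,q=0}^{K-1}.$$ Let $r_j$ be the number of distinct values among $\{\widehat a(j+nJ)\}_{n=0}^{m-1}$. Then for any such $K$ with $K\ge r_j$, $$\operatorname{rank}(H_K(j))\le r_j,$$ and for generic $f$ equality holds. In particular, if $\widehat a$ is real symmetric and strictly decreasing on $\{0,1,\dots,\frac{d-1}{2}\}$, then $$r_j=\begin{cases}\frac{m+1}{2}, & j=0,\\ m, & j>0.\end{cases}$$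
   Context: For a positive integer $N$, $\mathbb Z_N$ is the cyclic group of integers modulo $N$, and $\ell^2(\mathbb Z_N)$ is the space of functions $\mathbb Z_N\to\mathbb C$, identified with $\mathbb C^N$. The circular convolution of $a,f\in\ell^2(\mathbb Z_d)$ is $(a*f)(k)=\sum_{t\in\mathbb Z_d}a(t)f(k-t)$. Here $a^\ell*f$ denotes $A^\ell f$, where $A$ is the convolution operator $Af:=a*f$; that is, $a^0*f=f$ and $a^{\ell+1}*f=a*(a^\ell*f)$. The hat denotes the (unnormalized) discrete Fourier transform: for $z\in\ell^2(\mathbb Z_N)$, $\widehat z(k)=\sum_{t\in\mathbb Z_N}z(t)e^{-2\pi i kt/N}$. It is taken on $\mathbb Z_d$ for $a,f$ and on $\mathbb Z_J$ for $y_\ell$. The uniform subsampling operator $S_m:\ell^2(\mathbb Z_d)\to\ell^2(\mathbb Z_J)$ is $(S_mz)(j)=z(mj)$ for $j\in\mathbb Z_J$. "$\widehat a$ is real symmetric" means that $\widehat a(k)\in\mathbb R$ and $\widehat a(k)=\widehat a(d-k)$ for all $k\in\mathbb Z_d$ (indices modulo $d$). "For generic $f$" means (with $a$ and $j$ fixed) for all $f\in\ell^2(\mathbb Z_d)\cong\mathbb C^d$ outside some proper algebraic subset of $\mathbb C^d$. *)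

theory Defs
  imports Complex_Main "Jordan_Normal_Form.DL_Rank"
begin

text \<open>A function on \<open>\<int>/N\<close> is a vector of dimension \<open>N\<close>, whose entry at \<open>k\<close> with \<open>k < N\<close> is the value at
  the residue class of \<open>k\<close>.\<close>

definition dft :: "complex vec \<Rightarrow> complex vec" where
  "dft z = vec (dim_vec z) (\<lambda>k. \<Sum>t<dim_vec z.
     z $ t * exp (- (2 * of_real pi * \<i> * of_nat k * of_nat t / of_nat (dim_vec z))))"

text \<open>The index \<open>k + d - t\<close> avoids truncated subtraction on the natural numbers, as \<open>t < d\<close>.\<close>

definition conv :: "complex vec \<Rightarrow> complex vec \<Rightarrow> complex vec" where
  "conv a f = (let d = dim_vec f in vec d (\<lambda>k. \<Sum>t<d. a $ t * f $ ((k + d - t) mod d)))"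

definition subsample :: "nat \<Rightarrow> nat \<Rightarrow> complex vec \<Rightarrow> complex vec" where
  "subsample m J z = vec J (\<lambda>i. z $ (m * i))"

definition samples :: "nat \<Rightarrow> nat \<Rightarrow> complex vec \<Rightarrow> complex vec \<Rightarrow> nat \<Rightarrow> complex vec" where
  "samples m J a f l = subsample m J ((conv a ^^ l) f)"

definition hankel :: "nat \<Rightarrow> nat \<Rightarrow> complex vec \<Rightarrow> complex vec \<Rightarrow> nat \<Rightarrow> nat \<Rightarrow> complex mat" where
  "hankel m J a f j K = mat K K (\<lambda>(p, q). dft (samples m J a f (p + q)) $ j)"

definition num_distinct :: "nat \<Rightarrow> nat \<Rightarrow> complex vec \<Rightarrow> nat \<Rightarrow> nat" where
  "num_distinct m J a j = card ((\<lambda>n. dft a $ (j + n * J)) ` {..<m})"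

definition real_symmetric :: "complex vec \<Rightarrow> bool" where
  "real_symmetric z \<longleftrightarrow>
     (\<forall>k<dim_vec z. z $ k \<in> \<real> \<and> z $ k = z $ ((dim_vec z - k) mod dim_vec z))"

text \<open>Polynomials over the complex numbers are identified with the functions they induce; only the
  values on \<open>carrier_vec d\<close> matter below.  The defining set \<open>P\<close> of an algebraic subset may be infinite,
  which by Hilbert's basis theorem gives the same sets as finite \<open>P\<close>.\<close>

inductive_set poly_funs :: "nat \<Rightarrow> (complex vec \<Rightarrow> complex) set" for d :: nat where
  const: "(\<lambda>_. c) \<in> poly_funs d"
| coord: "i < d \<Longrightarrow> (\<lambda>v. v $ i) \<in> poly_funs d"
| add: "p \<in> poly_funs d \<Longrightarrow> q \<in> poly_funs d \<Longrightarrow> (\<lambda>v. p v + q v) \<in> poly_funs d"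
| mult: "p \<in> poly_funs d \<Longrightarrow> q \<in> poly_funs d \<Longrightarrow> (\<lambda>v. p v * q v) \<in> poly_funs d"

definition proper_algebraic_subset :: "nat \<Rightarrow> complex vec set \<Rightarrow> bool" where
  "proper_algebraic_subset d Z \<longleftrightarrow>
     (\<exists>P \<subseteq> poly_funs d. Z = {v \<in> carrier_vec d. \<forall>p\<in>P. p v = 0}) \<and> Z \<noteq> carrier_vec d"

end

theory Submission
  imports Defs "Jordan_Normal_Form.DL_Rank_Submatrix"
begin

text \<open>Convolution powers multiply the Fourier transform by powers of \<open>dft a\<close>, and subsampling
  averages it over the frequencies \<open>j + n * J\<close>.  Collecting equal values of \<open>dft a\<close>, the samples are
  \<open>s l = (\<Sum>x\<in>\<Lambda>. c x * x ^ l)\<close> where \<open>\<Lambda>\<close> is the set of the \<open>r\<close> distinct values.  So the Hankel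
  matrix is a sum of \<open>r\<close> matrices of rank at most one, and its leading \<open>r \<times> r\<close> minor is nonzero as
  soon as no \<open>c x\<close> vanishes.  The exceptional set is the zero set of \<open>\<Prod>x\<in>\<Lambda>. c x\<close>, a polynomial in
  \<open>f\<close> which does not vanish at the unit impulse.\<close>

section \<open>Roots of unity and their orthogonality\<close>

text \<open>The minus sign is that of the kernel in \<open>dft\<close>, which becomes
  \<open>unity_root N ^ (k * t)\<close>, so that exponents can be reduced modulo
  \<open>N\<close>.\<close>

definition unity_root :: "nat \<Rightarrow> complex" where
  "unity_root N = cis (- (2 * pi / real N))"

lemma unity_root_power: "unity_root N ^ k = cis (- (2 * pi * real k / real N))"
  by (simp add: unity_root_def DeMoivre algebra_simps)

lemma unity_root_power_eq_1: "N > 0 \<Longrightarrow> unity_root N ^ N = 1"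
  by (simp add: unity_root_power flip: cis_divide) (simp add: complex_eq_iff)

lemma unity_root_power_mod: "N > 0 \<Longrightarrow> unity_root N ^ (k mod N) = unity_root N ^ k"
proof -
  assume "N > 0"
  have "unity_root N ^ k = unity_root N ^ (N * (k div N) + k mod N)" by simp
  also have "\<dots> = unity_root N ^ (k mod N)"
    using \<open>N > 0\<close> by (simp only: power_add power_mult unity_root_power_eq_1 power_one mult_1)
  finally show ?thesis by simp
qed

lemma unity_root_power_cong:
  assumes "N > 0" "k mod N = l mod N"
  shows "unity_root N ^ k = unity_root N ^ l"
  using assms unity_root_power_mod by metis

text \<open>Used with either factor in the role of \<open>m\<close>, this relates the Fourier kernel
  of order \<open>m * J\<close> to those of order \<open>J\<close> and of order
  \<open>m\<close>.\<close>

lemma unity_root_mult_power: "m > 0 \<Longrightarrow> unity_root (m * J) ^ m = unity_root J"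
  by (simp add: unity_root_power) (simp add: unity_root_def)

lemma unity_root_power_neq_1:
  assumes N: "N > 0" and "\<not> N dvd k"
  shows "unity_root N ^ k \<noteq> 1"
proof
  assume eq: "unity_root N ^ k = 1"
  have "cos (2 * pi * real k / real N) = 1"
    using eq by (simp add: unity_root_power complex_eq_iff)
  then obtain x :: int where "2 * pi * real k / real N = of_int x * 2 * pi"
    by (auto simp: cos_one_2pi_int)
  then have "real k = of_int x * real N"
    using N by (simp add: field_simps)
  then have "int k = x * int N"
    by (metis of_int_eq_iff of_int_mult of_int_of_nat_eq)
  then show False
    using \<open>\<not> N dvd k\<close> by (metis dvd_triv_right int_dvd_int_iff)
qed

text \<open>If \<open>m\<close> does not divide \<open>t\<close>, the terms form a geometric
  progression whose ratio differs from 1 but has \<open>m\<close>-th power 1.\<close>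

lemma sum_unity_root_powers:
  assumes "m > 0"
  shows "(\<Sum>n<m. unity_root m ^ (n * t)) = (if m dvd t then of_nat m else 0)"
proof (cases "m dvd t")
  case True
  then have "unity_root m ^ (n * t) = 1" for n
    using unity_root_power_cong[OF assms, of "n * t" 0] by simp
  with True show ?thesis by simp
next
  case False
  have "(\<Sum>n<m. unity_root m ^ (n * t)) = (\<Sum>n<m. (unity_root m ^ t) ^ n)"
    by (simp add: mult.commute flip: power_mult)
  also have "\<dots> = ((unity_root m ^ t) ^ m - 1) / (unity_root m ^ t - 1)"
    using unity_root_power_neq_1[OF assms False] by (rule geometric_sum)
  also have "(unity_root m ^ t) ^ m = 1"
    using unity_root_power_cong[OF assms, of "t * m" 0] by (simp flip: power_mult)
  finally show ?thesis using False by simp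
qed

section \<open>The Fourier transform of convolution powers\<close>

lemma dim_dft [simp]: "dim_vec (dft z) = dim_vec z"
  by (simp add: dft_def)

lemma dft_index:
  assumes "z \<in> carrier_vec N" "k < N"
  shows "dft z $ k = (\<Sum>t<N. z $ t * unity_root N ^ (k * t))"
proof -
  have "unity_root N ^ (k * t) =
      exp (- (2 * of_real pi * \<i> * of_nat k * of_nat t / of_nat N))" for t
    unfolding unity_root_power cis_conv_exp by (simp add: algebra_simps)
  with assms show ?thesis by (simp add: dft_def)
qed

lemma conv_carrier [simp]: "f \<in> carrier_vec d \<Longrightarrow> conv a f \<in> carrier_vec d"
  by (auto simp: conv_def Let_def)

lemma conv_power_carrier [simp]: "f \<in> carrier_vec d \<Longrightarrow> (conv a ^^ l) f \<in> carrier_vec d"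
  by (induction l) auto

lemma sum_cyclic_shift:
  fixes d t :: nat
  assumes "t < d"
  shows "(\<Sum>s<d. g ((s + d - t) mod d)) = (\<Sum>s<d. g s)"
proof (rule sum.reindex_bij_betw)
  have 1: "((s + d - t) mod d + t) mod d = s" if "s < d" for s
  proof -
    have "((s + d - t) mod d + t) mod d = (s + d - t + t) mod d" by (simp add: mod_simps)
    with assms that show ?thesis by simp
  qed
  have 2: "((s + t) mod d + d - t) mod d = s" if "s < d" for s
  proof -
    have "((s + t) mod d + d - t) mod d = ((s + t) mod d + (d - t)) mod d"
      using assms by simp
    also have "\<dots> = (s + t + (d - t)) mod d" by (simp add: mod_simps)
    finally show ?thesis using assms that by simp
  qed
  show "bij_betw (\<lambda>s. (s + d - t) mod d) {..<d} {..<d}"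
    by (rule bij_betw_byWitness[where f' = "\<lambda>s. (s + t) mod d"]) (use 1 2 in auto)
qed

lemma dft_conv:
  assumes a: "a \<in> carrier_vec d" and f: "f \<in> carrier_vec d" and k: "k < d"
  shows "dft (conv a f) $ k = dft a $ k * dft f $ k"
proof -
  let ?w = "unity_root d"
  have d: "d > 0" using k by simp
  \<comment> \<open>The kernel is multiplicative along \<open>s = t + (s - t)\<close>. The exponents
    on the two sides agree modulo \<open>d\<close>, which suffices.\<close>
  have shift: "?w ^ (k * s) = ?w ^ (k * t) * ?w ^ (k * ((s + d - t) mod d))" if "t < d" for s t
  proof -
    have "(k * t + k * ((s + d - t) mod d)) mod d = (k * t + k * (s + d - t)) mod d"
      by (metis mod_add_right_eq mod_mult_right_eq)
    also have "k * t + k * (s + d - t) = k * s + k * d"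
      using that by (simp flip: distrib_left)
    finally show ?thesis
      using unity_root_power_cong[OF d, of "k * t + k * ((s + d - t) mod d)" "k * s"]
      by (simp add: power_add)
  qed
  have "dft (conv a f) $ k = (\<Sum>s<d. (\<Sum>t<d. a $ t * f $ ((s + d - t) mod d)) * ?w ^ (k * s))"
    using f k by (simp add: dft_index[of _ d]) (use f in \<open>auto simp: conv_def\<close>)
  also have "\<dots> = (\<Sum>t<d. \<Sum>s<d. a $ t * f $ ((s + d - t) mod d) * ?w ^ (k * s))"
    by (subst sum.swap) (simp add: sum_distrib_right)
  also have "\<dots> = (\<Sum>t<d. a $ t * ?w ^ (k * t) *
      (\<Sum>s<d. f $ ((s + d - t) mod d) * ?w ^ (k * ((s + d - t) mod d))))"
  proof (intro sum.cong refl)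
    fix t assume t: "t \<in> {..<d}"
    then have "?w ^ (k * s) = ?w ^ (k * t) * ?w ^ (k * ((s + d - t) mod d))" for s
      by (intro shift) simp
    then show "(\<Sum>s<d. a $ t * f $ ((s + d - t) mod d) * ?w ^ (k * s)) = a $ t * ?w ^ (k * t) *
        (\<Sum>s<d. f $ ((s + d - t) mod d) * ?w ^ (k * ((s + d - t) mod d)))"
      unfolding sum_distrib_left by (intro sum.cong refl) (simp only: mult_ac)
  qed
  \<comment> \<open>The inner sum runs over a full period, so the shift by \<open>t\<close> drops
    out and the double sum factors.\<close>
  also have "\<dots> = (\<Sum>t<d. a $ t * ?w ^ (k * t) * (\<Sum>s<d. f $ s * ?w ^ (k * s)))"
    by (intro sum.cong refl) (simp add: sum_cyclic_shift[where g = "\<lambda>s. f $ s * ?w ^ (k * s)"])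
  finally show ?thesis
    using a f k by (simp add: dft_index[of _ d] sum_distrib_right)
qed

lemma dft_conv_power:
  assumes "a \<in> carrier_vec d" "f \<in> carrier_vec d" "k < d"
  shows "dft ((conv a ^^ l) f) $ k = (dft a $ k) ^ l * dft f $ k"
  using assms by (induction l) (auto simp: dft_conv)

section \<open>Aliasing, and the samples as exponential sums\<close>

lemma alias_index_less:
  fixes j n m J :: nat
  assumes "j < J" "n < m"
  shows "j + n * J < m * J"
proof -
  have "j + n * J < Suc n * J" using assms by simp
  also have "\<dots> \<le> m * J" using assms by (intro mult_le_mono1) simp
  finally show ?thesis .
qed

text \<open>The kernel at frequency \<open>j + n * J\<close> is the one at \<open>j\<close> times
  \<open>unity_root m ^ (n * t)\<close>. Summing over \<open>n\<close> removes every time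
  \<open>t\<close> that is not a multiple of \<open>m\<close>, and the remaining times are the
  subsampled ones.\<close>

lemma dft_subsample:
  assumes z: "z \<in> carrier_vec (m * J)" and m: "m > 0" and j: "j < J"
  shows "dft (subsample m J z) $ j = (\<Sum>n<m. dft z $ (j + n * J)) / of_nat m"
proof -
  let ?w = "unity_root (m * J)"
  have J: "J > 0" using j by simp
  have w: "?w ^ J = unity_root m"
    using unity_root_mult_power[OF J, of m] by (simp add: mult.commute)
  have split: "?w ^ ((j + n * J) * t) = ?w ^ (j * t) * unity_root m ^ (n * t)" for n t
    unfolding w[symmetric] power_mult[symmetric] power_add[symmetric] by (simp add: algebra_simps)
  have "(\<Sum>n<m. dft z $ (j + n * J)) =
      (\<Sum>n<m. \<Sum>t<m * J. z $ t * ?w ^ ((j + n * J) * t))"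
    using z j by (intro sum.cong refl dft_index) (auto simp: alias_index_less)
  also have "\<dots> = (\<Sum>t<m * J. z $ t * ?w ^ (j * t) * (\<Sum>n<m. unity_root m ^ (n * t)))"
    unfolding sum_distrib_left
    by (subst sum.swap) (simp add: split mult.assoc)
  also have "\<dots> = (\<Sum>t<m * J. if m dvd t then of_nat m * (z $ t * ?w ^ (j * t)) else 0)"
    unfolding sum_unity_root_powers[OF m] by (intro sum.cong) auto
  also have "\<dots> = (\<Sum>t \<in> (*) m ` {..<J}. of_nat m * (z $ t * ?w ^ (j * t)))"
    using m by (intro sum.mono_neutral_cong_right) auto
  also have "\<dots> = (\<Sum>i<J. of_nat m * (z $ (m * i) * ?w ^ (j * (m * i))))"
    using m by (subst sum.reindex) (auto simp: inj_on_def)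
  also have "\<dots> = of_nat m * (\<Sum>i<J. z $ (m * i) * unity_root J ^ (j * i))"
    by (simp add: sum_distrib_left mult.left_commute flip: power_mult unity_root_mult_power[OF m, of J])
  also have "\<dots> = of_nat m * dft (subsample m J z) $ j"
    using j by (subst dft_index[where N = J]) (auto simp: subsample_def)
  finally show ?thesis using m by simp
qed

text \<open>This is the coefficient \<open>c x\<close> of the exponential sum: aliased frequencies
  with equal values of \<open>dft a\<close> enter the samples only through the sum of their
  \<open>dft f\<close>. The division by \<open>m\<close> comes from aliasing.\<close>

definition node_weight :: "nat \<Rightarrow> nat \<Rightarrow> complex vec \<Rightarrow> nat \<Rightarrow> complex vec \<Rightarrow> complex \<Rightarrow> complex" where
  "node_weight m J a j f x =
     (\<Sum>n\<in>{n \<in> {..<m}. dft a $ (j + n * J) = x}. dft f $ (j + n * J)) / of_nat m"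

lemma dft_samples:
  assumes a: "a \<in> carrier_vec (m * J)" and f: "f \<in> carrier_vec (m * J)" and "m > 0" "j < J"
  shows "dft (samples m J a f l) $ j =
    (\<Sum>x\<in>(\<lambda>n. dft a $ (j + n * J)) ` {..<m}. node_weight m J a j f x * x ^ l)"
proof -
  let ?ev = "\<lambda>n. dft a $ (j + n * J)"
  have "dft (samples m J a f l) $ j = (\<Sum>n<m. ?ev n ^ l * dft f $ (j + n * J)) / of_nat m"
    unfolding samples_def using assms
    by (simp add: dft_subsample dft_conv_power alias_index_less)
  also have "(\<Sum>n<m. ?ev n ^ l * dft f $ (j + n * J)) =
      (\<Sum>x\<in>?ev ` {..<m}. \<Sum>n\<in>{n \<in> {..<m}. ?ev n = x}. ?ev n ^ l * dft f $ (j + n * J))"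
    by (rule sum.image_gen) simp
  also have "\<dots> = (\<Sum>x\<in>?ev ` {..<m}. x ^ l * (\<Sum>n\<in>{n \<in> {..<m}. ?ev n = x}. dft f $ (j + n * J)))"
    by (simp add: sum_distrib_left)
  finally show ?thesis
    unfolding node_weight_def
    by (simp only: sum_divide_distrib[of _ "_ ` _"] times_divide_eq_left times_divide_eq_right
        mult.commute)
qed

section \<open>The rank of Hankel matrices of exponential sums\<close>

text \<open>For finite \<open>S\<close> this is the product V^T D V, with V the Vandermonde matrix
  of the nodes and D the diagonal matrix of the weights.\<close>

definition hankel_of_nodes :: "nat \<Rightarrow> 'a :: field set \<Rightarrow> ('a \<Rightarrow> 'a) \<Rightarrow> 'a mat" where
  "hankel_of_nodes K S c = mat K K (\<lambda>(p, q). \<Sum>x\<in>S. c x * x ^ (p + q))"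

lemma hankel_of_nodes_carrier [simp]: "hankel_of_nodes K S c \<in> carrier_mat K K"
  by (simp add: hankel_of_nodes_def)

lemma rank_hankel_of_nodes_le:
  assumes "finite S"
  shows "vec_space.rank K (hankel_of_nodes K S c) \<le> card S"
  using assms
proof (induction S)
  case empty
  have "hankel_of_nodes K {} c = 0\<^sub>m K K"
    by (rule eq_matI) (auto simp: hankel_of_nodes_def)
  then show ?case by (simp add: vec_space.rank_0I)
next
  case (insert y S)
  have "hankel_of_nodes K (insert y S) c = hankel_of_nodes K {y} c + hankel_of_nodes K S c"
    using insert.hyps by (intro eq_matI) (auto simp: hankel_of_nodes_def)
  then have "vec_space.rank K (hankel_of_nodes K (insert y S) c) \<le>
      vec_space.rank K (hankel_of_nodes K {y} c) + vec_space.rank K (hankel_of_nodes K S c)"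
    using vec_space.rank_subadditive[OF hankel_of_nodes_carrier hankel_of_nodes_carrier] by simp
  \<comment> \<open>Since \<open>y ^ (p + q)\<close> factors, a single node gives an outer
    product.\<close>
  also have "vec_space.rank K (hankel_of_nodes K {y} c) \<le> 1"
    by (rule vec_space.rank_le_1_product_entries[OF hankel_of_nodes_carrier,
          of _ _ _ "\<lambda>p. c y * y ^ p" "\<lambda>q. y ^ q"])
       (auto simp: hankel_of_nodes_def power_add)
  finally show ?case using insert by simp
qed

text \<open>If the matrix annihilates the coefficient vector of a polynomial \<open>P\<close> of degree less than
  \<open>card S\<close>, then \<open>\<Sum>x\<in>S. c x * Q x * P x = 0\<close> for all polynomials \<open>Q\<close> of degree less than
  \<open>card S\<close>.  Taking for \<open>Q\<close> the Lagrange polynomials of the nodes shows that \<open>P\<close> vanishes on \<open>S\<close>.\<close>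

lemma det_hankel_of_nodes_neq_0:
  fixes S :: "'a :: field set"
  assumes S: "finite S" and c: "\<And>x. x \<in> S \<Longrightarrow> c x \<noteq> 0"
  shows "det (hankel_of_nodes (card S) S c) \<noteq> 0"
proof
  let ?r = "card S"
  let ?H = "hankel_of_nodes ?r S c"
  assume "det ?H = 0"
  then obtain v where v: "v \<in> carrier_vec ?r" "v \<noteq> 0\<^sub>v ?r" "?H *\<^sub>v v = 0\<^sub>v ?r"
    using det_0_iff_vec_prod_zero_field[OF hankel_of_nodes_carrier] by blast
  define P where "P = (\<Sum>q<?r. monom (v $ q) q)"
  have polyP: "poly P x = (\<Sum>q<?r. v $ q * x ^ q)" for x
    by (simp add: P_def poly_sum poly_monom)
  have moment: "(\<Sum>x\<in>S. c x * x ^ p * poly P x) = 0" if p: "p < ?r" for p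
  proof -
    have "0 = (?H *\<^sub>v v) $ p" using p v(3) by simp
    also have "\<dots> = (\<Sum>q<?r. (\<Sum>x\<in>S. c x * x ^ (p + q)) * v $ q)"
      using p v(1) by (simp add: hankel_of_nodes_def scalar_prod_def lessThan_atLeast0)
    also have "\<dots> = (\<Sum>x\<in>S. c x * x ^ p * poly P x)"
      unfolding polyP sum_distrib_left sum_distrib_right
      by (subst sum.swap) (simp add: power_add mult_ac)
    finally show ?thesis by simp
  qed
  have pairing: "(\<Sum>x\<in>S. c x * poly Q x * poly P x) = 0" if Q: "degree Q < ?r" for Q
  proof -
    have "(\<Sum>x\<in>S. c x * poly Q x * poly P x) =
        (\<Sum>p\<le>degree Q. coeff Q p * (\<Sum>x\<in>S. c x * x ^ p * poly P x))"
      unfolding poly_altdef[of Q] sum_distrib_left sum_distrib_right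
      by (subst sum.swap) (simp add: mult_ac)
    also have "\<dots> = 0" using Q by (intro sum.neutral) (auto simp: moment)
    finally show ?thesis .
  qed
  have roots: "poly P y = 0" if y: "y \<in> S" for y
  proof -
    \<comment> \<open>The Lagrange polynomial of \<open>y\<close> without its normalising factor: of
      degree \<open>?r - 1\<close>, it isolates the term of \<open>y\<close> in the pairing.\<close>
    define Q where "Q = (\<Prod>x\<in>S - {y}. [:- x, 1:])"
    have "degree Q \<le> (\<Sum>x\<in>S - {y}. degree [:- x, 1:])"
      unfolding Q_def by (rule degree_prod_sum_le[unfolded o_def]) (use S in simp)
    also have "\<dots> = ?r - 1" using S y by simp
    also have "\<dots> < ?r" using card_gt_0_iff[of S] S y by auto
    finally have "degree Q < ?r" .
    from pairing[OF this] have "0 = (\<Sum>x\<in>S. c x * poly Q x * poly P x)" by simp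
    also have "\<dots> = (\<Sum>x\<in>{y}. c x * poly Q x * poly P x)"
      using S y by (intro sum.mono_neutral_right) (auto simp: Q_def poly_prod)
    finally have "c y * poly Q y * poly P y = 0" by simp
    moreover have "poly Q y \<noteq> 0" using S by (auto simp: Q_def poly_prod)
    ultimately show ?thesis using c[OF y] by simp
  qed
  have coeffP: "coeff P q = v $ q" if "q < ?r" for q
    using that by (simp add: P_def coeff_sum if_distrib cong: if_cong)
  have "P = 0"
  proof (rule ccontr)
    assume "P \<noteq> 0"
    \<comment> \<open>A nonzero vector has positive dimension. Hence \<open>?r - 1 < ?r\<close>, and
      \<open>P\<close> has more roots than its degree allows.\<close>
    have "?r > 0" using v by (cases "?r = 0") auto
    have "?r \<le> card {x. poly P x = 0}"
      using roots poly_roots_finite[OF \<open>P \<noteq> 0\<close>] by (intro card_mono) auto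
    also have "\<dots> \<le> degree P" by (rule card_poly_roots_bound) fact
    also have "\<dots> \<le> ?r - 1"
      unfolding P_def by (rule degree_sum_le) (auto intro: order.trans[OF degree_monom_le])
    finally show False using \<open>?r > 0\<close> by simp
  qed
  with coeffP v(1) have "v = 0\<^sub>v ?r" by (intro eq_vecI) auto
  with v(2) show False by simp
qed

lemma submatrix_hankel_of_nodes:
  assumes "r \<le> K"
  shows "submatrix (hankel_of_nodes K S c) {..<r} {..<r} = hankel_of_nodes r S c"
proof (rule eq_matI)
  have card: "card {i. i < K \<and> i \<in> {..<r}} = r"
  proof -
    have "{i. i < K \<and> i \<in> {..<r}} = {..<r}" using assms by auto
    then show ?thesis by simp
  qed
  show "dim_row (submatrix (hankel_of_nodes K S c) {..<r} {..<r}) = dim_row (hankel_of_nodes r S c)"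
    "dim_col (submatrix (hankel_of_nodes K S c) {..<r} {..<r}) = dim_col (hankel_of_nodes r S c)"
    using card by (simp_all add: dim_submatrix hankel_of_nodes_def)
  fix p q assume "p < dim_row (hankel_of_nodes r S c)" "q < dim_col (hankel_of_nodes r S c)"
  then have pq: "p < r" "q < r" by (simp_all add: hankel_of_nodes_def)
  \<comment> \<open>A submatrix renumbers an index by counting the selected indices below it; on an
    initial segment this changes nothing.\<close>
  have initial: "card {n \<in> {..<r}. n < i} = i" if "i < r" for i
  proof -
    have "{n \<in> {..<r}. n < i} = {..<i}" using that by auto
    then show ?thesis by simp
  qed
  show "submatrix (hankel_of_nodes K S c) {..<r} {..<r} $$ (p, q) = hankel_of_nodes r S c $$ (p, q)"
    using submatrix_index_card[of p "hankel_of_nodes K S c" q "{..<r}" "{..<r}"] pq assms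
    by (simp add: initial[OF pq(1), simplified] initial[OF pq(2), simplified])
       (simp add: hankel_of_nodes_def)
qed

lemma rank_hankel_of_nodes:
  fixes S :: "'a :: field set"
  assumes S: "finite S" and c: "\<And>x. x \<in> S \<Longrightarrow> c x \<noteq> 0" and K: "card S \<le> K"
  shows "vec_space.rank K (hankel_of_nodes K S c) = card S"
proof (rule antisym[OF rank_hankel_of_nodes_le[OF S]])
  \<comment> \<open>A nonzero minor bounds the rank below by the number of selected columns that lie
    in the matrix, here \<open>card S\<close>.\<close>
  have "{q. q < K \<and> q \<in> {..<card S}} = {..<card S}" using K by auto
  then show "card S \<le> vec_space.rank K (hankel_of_nodes K S c)"
    using vec_space.rank_gt_minor[OF hankel_of_nodes_carrier, of K S c "{..<card S}" "{..<card S}"]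
      det_hankel_of_nodes_neq_0[OF S c] submatrix_hankel_of_nodes[OF K, of S c] by simp
qed

lemma hankel_eq_hankel_of_nodes:
  assumes "a \<in> carrier_vec (m * J)" "f \<in> carrier_vec (m * J)" "m > 0" "j < J"
  shows "hankel m J a f j K =
    hankel_of_nodes K ((\<lambda>n. dft a $ (j + n * J)) ` {..<m}) (node_weight m J a j f)"
  unfolding hankel_def hankel_of_nodes_def
  by (rule eq_matI) (use assms in \<open>auto simp: dft_samples\<close>)

section \<open>The exceptional set is a proper algebraic subset\<close>

lemma poly_funs_sum:
  "(\<And>i. i \<in> A \<Longrightarrow> p i \<in> poly_funs d) \<Longrightarrow> (\<lambda>v. \<Sum>i\<in>A. p i v) \<in> poly_funs d"
  by (induction A rule: infinite_finite_induct) (auto intro: poly_funs.intros)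

lemma poly_funs_prod:
  "(\<And>i. i \<in> A \<Longrightarrow> p i \<in> poly_funs d) \<Longrightarrow> (\<lambda>v. \<Prod>i\<in>A. p i v) \<in> poly_funs d"
  by (induction A rule: infinite_finite_induct) (auto intro: poly_funs.intros)

lemma proper_algebraic_zero_weights:
  assumes a: "a \<in> carrier_vec (m * J)" and m: "m > 0" and j: "j < J"
  shows "proper_algebraic_subset (m * J) {f \<in> carrier_vec (m * J).
    \<exists>x\<in>(\<lambda>n. dft a $ (j + n * J)) ` {..<m}. node_weight m J a j f x = 0}"
    (is "proper_algebraic_subset ?d ?Z")
  unfolding proper_algebraic_subset_def
proof (intro conjI exI)
  let ?\<Lambda> = "(\<lambda>n. dft a $ (j + n * J)) ` {..<m}"
  \<comment> \<open>\<open>dft f\<close> depends on \<open>dim_vec f\<close>, so the weights are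
    spelled out as linear forms in the coordinates, with the factor \<open>1 / m\<close> dropped.
    The two descriptions are compared on \<open>carrier_vec\<close> only.\<close>
  let ?p = "\<lambda>f. \<Prod>x\<in>?\<Lambda>. \<Sum>n\<in>{n \<in> {..<m}. dft a $ (j + n * J) = x}.
      \<Sum>t<?d. f $ t * unity_root ?d ^ ((j + n * J) * t)"
  show "{?p} \<subseteq> poly_funs ?d"
    by (auto intro!: poly_funs_prod poly_funs_sum poly_funs.mult poly_funs.coord poly_funs.const)
  have weight: "node_weight m J a j f x = (\<Sum>n\<in>{n \<in> {..<m}. dft a $ (j + n * J) = x}.
      \<Sum>t<?d. f $ t * unity_root ?d ^ ((j + n * J) * t)) / of_nat m" if "f \<in> carrier_vec ?d" for f x
    unfolding node_weight_def
    by (intro arg_cong2[where f = "(/)"] sum.cong refl dft_index that) (auto simp: alias_index_less j)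
  show "?Z = {f \<in> carrier_vec ?d. \<forall>p\<in>{?p}. p f = 0}"
    using m by (auto simp: weight)
  have d: "?d > 0" using m j by simp
  \<comment> \<open>All Fourier coefficients of the unit impulse are 1, so its weight at
    \<open>x\<close> is the multiplicity of \<open>x\<close> divided by \<open>m\<close>.\<close>
  have "node_weight m J a j (unit_vec ?d 0) x \<noteq> 0" if x: "x \<in> ?\<Lambda>" for x
  proof -
    have "(\<Sum>t<?d. unit_vec ?d 0 $ t * unity_root ?d ^ (k * t)) = 1" for k
      using d by (subst sum.remove[of _ 0]) auto
    then have "node_weight m J a j (unit_vec ?d 0) x =
        of_nat (card {n \<in> {..<m}. dft a $ (j + n * J) = x}) / of_nat m"
      by (simp add: weight)
    then show ?thesis using x m by auto
  qed
  then have "unit_vec ?d 0 \<in> carrier_vec ?d - ?Z" by auto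
  then show "?Z \<noteq> carrier_vec ?d" by blast
qed

section \<open>Counting distinct values of a symmetric decreasing spectrum\<close>

text \<open>Reflection folds every index into the lower half, where strict decrease gives
  injectivity. So only mirror images can collide.\<close>

lemma real_symmetric_antimono_eq_iff:
  fixes z :: "complex vec"
  assumes sym: "real_symmetric z" and d: "dim_vec z = d" "odd d"
    and anti: "strict_antimono_on {0..(d - 1) div 2} (\<lambda>k. Re (z $ k))"
    and kl: "k < d" "l < d"
  shows "z $ k = z $ l \<longleftrightarrow> k = l \<or> k + l = d"
proof -
  \<comment> \<open>Index 0 is excluded: it is its own mirror image modulo \<open>d\<close>, while
    \<open>d - 0\<close> is out of range.\<close>
  have refl: "z $ i = z $ (d - i)" if "0 < i" "i < d" for i
  proof -
    have "z $ i = z $ ((d - i) mod d)" using sym d(1) that by (simp only: real_symmetric_def)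
    with that show ?thesis by simp
  qed
  have inj: "i = i'" if "z $ i = z $ i'" "i \<le> (d - 1) div 2" "i' \<le> (d - 1) div 2" for i i'
  proof (rule ccontr)
    assume "i \<noteq> i'"
    then consider "i < i'" | "i' < i" by linarith
    then show False using anti that by cases (fastforce simp: monotone_on_def)+
  qed
  define fold where "fold i = (if i \<le> (d - 1) div 2 then i else d - i)" for i
  have fold: "z $ i = z $ fold i" "fold i \<le> (d - 1) div 2" if "i < d" for i
    using refl[of i] that d(2) by (auto simp: fold_def elim!: oddE)
  show ?thesis
  proof
    assume "z $ k = z $ l"
    with fold kl have "fold k = fold l" by (intro inj) metis+
    with kl show "k = l \<or> k + l = d" by (auto simp: fold_def split: if_splits)
  next
    assume "k = l \<or> k + l = d"
    with refl[of k] kl show "z $ k = z $ l" by auto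
  qed
qed

lemma num_distinct_real_symmetric:
  assumes d: "d = m * J" "odd d" and a: "a \<in> carrier_vec d" and j: "j < J"
    and sym: "real_symmetric (dft a)"
    and anti: "strict_antimono_on {0..(d - 1) div 2} (\<lambda>k. Re (dft a $ k))"
  shows "num_distinct m J a j = (if j = 0 then (m + 1) div 2 else m)"
proof -
  let ?ev = "\<lambda>n. dft a $ (j + n * J)"
  have odd: "odd m" "odd J" using d by auto
  have J: "J > 0" using j by simp
  \<comment> \<open>The second alternative says that \<open>j + n * J\<close> and
    \<open>j + n' * J\<close> add up to \<open>d\<close>.\<close>
  have eq_iff: "?ev n = ?ev n' \<longleftrightarrow> n = n' \<or> 2 * j + (n + n') * J = m * J" if "n < m" "n' < m" for n n'
    using real_symmetric_antimono_eq_iff[OF sym _ d(2) anti, of "j + n * J" "j + n' * J"]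
      alias_index_less[OF j that(1)] alias_index_less[OF j that(2)] that a d(1) J
    by (auto simp: algebra_simps)
  show ?thesis
  proof (cases "j = 0")
    case True
    have eq_iff0: "?ev n = ?ev n' \<longleftrightarrow> n = n' \<or> n + n' = m" if "n < m" "n' < m" for n n'
      using eq_iff[OF that] True J by simp
    \<comment> \<open>Reflection pairs \<open>n\<close> with \<open>m - n\<close> and leaves 0
      alone, so the lower half, of size \<open>(m + 1) div 2\<close>, represents all values.\<close>
    have "?ev ` {..<m} = ?ev ` {..(m - 1) div 2}"
    proof (intro equalityI image_subsetI)
      fix n assume n: "n \<in> {..<m}"
      show "?ev n \<in> ?ev ` {..(m - 1) div 2}"
      proof (cases "n \<le> (m - 1) div 2")
        case False
        then have "m - n \<le> (m - 1) div 2" using odd(1) by (auto elim!: oddE)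
        moreover have "?ev n = ?ev (m - n)" using eq_iff0[of n "m - n"] n False by auto
        ultimately show ?thesis by blast
      qed auto
    next
      fix n assume "n \<in> {..(m - 1) div 2}"
      then show "?ev n \<in> ?ev ` {..<m}" using odd(1) by (intro imageI) (auto elim!: oddE)
    qed
    moreover have "inj_on ?ev {..(m - 1) div 2}"
      using odd(1) by (intro inj_onI) (subst (asm) eq_iff0, auto elim!: oddE)
    ultimately show ?thesis
      using True odd(1) by (auto simp: num_distinct_def card_image elim!: oddE)
  next
    case False
    \<comment> \<open>A collision would make \<open>J\<close> divide \<open>2 * j\<close>, hence
      \<open>j\<close> because \<open>J\<close> is odd, against \<open>0 < j < J\<close>.\<close>
    have "2 * j + (n + n') * J \<noteq> m * J" for n n'
    proof
      assume "2 * j + (n + n') * J = m * J"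
      then have "J dvd 2 * j" by (metis dvd_add_left_iff dvd_triv_right)
      then have "J dvd j" using odd(2) by (simp add: coprime_dvd_mult_right_iff)
      with False j show False by (auto dest: dvd_imp_le)
    qed
    with eq_iff have "inj_on ?ev {..<m}" by (intro inj_onI) auto
    with False show ?thesis by (simp add: num_distinct_def card_image)
  qed
qed

theorem theorem1:
  fixes d m J j :: nat and a :: "complex vec"
  assumes "d = m * J" and "m \<ge> 2" and "J \<ge> 1" and "odd d"
    and "a \<in> carrier_vec d" and "j < J"
  shows "(\<forall>f \<in> carrier_vec d. \<forall>L K. 1 \<le> L \<longrightarrow> 1 \<le> K \<longrightarrow> 2 * K \<le> L \<longrightarrow> num_distinct m J a j \<le> K \<longrightarrow>
            vec_space.rank K (hankel m J a f j K) \<le> num_distinct m J a j) \<and>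
         (\<exists>Z. proper_algebraic_subset d Z \<and>
            (\<forall>f \<in> carrier_vec d - Z. \<forall>L K. 1 \<le> L \<longrightarrow> 1 \<le> K \<longrightarrow> 2 * K \<le> L \<longrightarrow> num_distinct m J a j \<le> K \<longrightarrow>
              vec_space.rank K (hankel m J a f j K) = num_distinct m J a j)) \<and>
         (real_symmetric (dft a) \<longrightarrow>
          strict_antimono_on {0..(d - 1) div 2} (\<lambda>k. Re (dft a $ k)) \<longrightarrow>
            num_distinct m J a j = (if j = 0 then (m + 1) div 2 else m))"
proof (intro conjI impI ballI)
  let ?\<Lambda> = "(\<lambda>n. dft a $ (j + n * J)) ` {..<m}"
  \<comment> \<open>The set mentions neither \<open>K\<close> nor \<open>L\<close>, so one
    exceptional set serves all matrix sizes.\<close>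
  let ?Z = "{f \<in> carrier_vec d. \<exists>x\<in>?\<Lambda>. node_weight m J a j f x = 0}"
  have m: "m > 0" using assms(2) by simp
  have H: "hankel m J a f j K = hankel_of_nodes K ?\<Lambda> (node_weight m J a j f)"
    if "f \<in> carrier_vec d" for f K
    using hankel_eq_hankel_of_nodes assms that m by simp
  show "\<forall>L K. 1 \<le> L \<longrightarrow> 1 \<le> K \<longrightarrow> 2 * K \<le> L \<longrightarrow> num_distinct m J a j \<le> K \<longrightarrow>
      vec_space.rank K (hankel m J a f j K) \<le> num_distinct m J a j"
    if "f \<in> carrier_vec d" for f
    by (simp add: H[OF that] num_distinct_def rank_hankel_of_nodes_le)
  have "proper_algebraic_subset d ?Z"
    using proper_algebraic_zero_weights assms m by simp
  moreover have "vec_space.rank K (hankel m J a f j K) = num_distinct m J a j"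
    if "f \<in> carrier_vec d - ?Z" "num_distinct m J a j \<le> K" for f K
    using that rank_hankel_of_nodes[of ?\<Lambda> "node_weight m J a j f" K]
    by (auto simp: H num_distinct_def)
  ultimately show "\<exists>Z. proper_algebraic_subset d Z \<and>
      (\<forall>f \<in> carrier_vec d - Z. \<forall>L K. 1 \<le> L \<longrightarrow> 1 \<le> K \<longrightarrow> 2 * K \<le> L \<longrightarrow> num_distinct m J a j \<le> K \<longrightarrow>
        vec_space.rank K (hankel m J a f j K) = num_distinct m J a j)"
    by blast
  show "num_distinct m J a j = (if j = 0 then (m + 1) div 2 else m)"
    if "real_symmetric (dft a)" "strict_antimono_on {0..(d - 1) div 2} (\<lambda>k. Re (dft a $ k))"
    using num_distinct_real_symmetric[OF assms(1,4-6) that] .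
qed

end
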